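(* If $H$ and $K$ are finite groups with relatively prime orders, then $\operatorname{Atp}(H\times K)\cong\operatorname{Atp}(H)\times\operatorname{Atp}(K)$.
   Context: An autotopism of a group $(G,\cdot)$ is a triple $(\alpha,\beta,\gamma)$ of bijections $G\to G$ such that $\alpha(x)\cdot\beta(y)=\gamma(x\cdot y)$ for all $x,y\in G$. $\operatorname{Atp}(G)$ is the group of all autotopisms of $G$ under componentwise composition $(\alpha,\beta,\gamma)(\alpha',\beta',\gamma')=(\alpha\circ\alpha',\beta\circ\beta',\gamma\circ\gamma')$. *)

theory Defs
  imports "HOL-Algebra.Coset" "HOL-Algebra.Bij"
begin

text \<open>
  Following \<open>HOL-Algebra.Bij\<close>, a bijection of \<open>carrier G\<close> is represented by the unique function in
  \<^const>\<open>Bij\<close> that agrees with it on the carrier and is undefined elsewhere, so that distinct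
  elements of \<open>autotopisms G\<close> are distinct triples of bijections of the carrier.
\<close>

definition autotopisms ::
    "('a, 'm) monoid_scheme \<Rightarrow> (('a \<Rightarrow> 'a) \<times> ('a \<Rightarrow> 'a) \<times> ('a \<Rightarrow> 'a)) set"
  where "autotopisms G =
    {(\<alpha>, \<beta>, \<gamma>). \<alpha> \<in> Bij (carrier G) \<and> \<beta> \<in> Bij (carrier G) \<and> \<gamma> \<in> Bij (carrier G) \<and>
      (\<forall>x \<in> carrier G. \<forall>y \<in> carrier G. \<alpha> x \<otimes>\<^bsub>G\<^esub> \<beta> y = \<gamma> (x \<otimes>\<^bsub>G\<^esub> y))}"

definition Atp ::
    "('a, 'm) monoid_scheme \<Rightarrow> (('a \<Rightarrow> 'a) \<times> ('a \<Rightarrow> 'a) \<times> ('a \<Rightarrow> 'a)) monoid"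
  where "Atp G =
    (BijGroup (carrier G) \<times>\<times> BijGroup (carrier G) \<times>\<times> BijGroup (carrier G))
      \<lparr>carrier := autotopisms G\<rparr>"

lemma carrier_Atp [simp]: "carrier (Atp G) = autotopisms G"
  by (simp add: Atp_def)

lemma mult_Atp:
  assumes "(\<alpha>, \<beta>, \<gamma>) \<in> autotopisms G" and "(\<alpha>', \<beta>', \<gamma>') \<in> autotopisms G"
  shows "(\<alpha>, \<beta>, \<gamma>) \<otimes>\<^bsub>Atp G\<^esub> (\<alpha>', \<beta>', \<gamma>') =
    (compose (carrier G) \<alpha> \<alpha>', compose (carrier G) \<beta> \<beta>', compose (carrier G) \<gamma> \<gamma>')"
  using assms by (simp add: Atp_def DirProd_def BijGroup_def autotopisms_def)

lemma one_Atp: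
  "\<one>\<^bsub>Atp G\<^esub> = (\<lambda>x \<in> carrier G. x, \<lambda>x \<in> carrier G. x, \<lambda>x \<in> carrier G. x)"
  by (simp add: Atp_def DirProd_def BijGroup_def)

lemma group_Atp:
  assumes "group G"
  shows "group (Atp G)"
proof -
  interpret G: group G by fact
  let ?S = "carrier G"
  have mem: "f x \<in> ?S" if "f \<in> Bij ?S" "x \<in> ?S" for f x
    using Bij_imp_funcset[OF that(1)] that(2) by blast
  have closed: "t \<otimes>\<^bsub>Atp G\<^esub> u \<in> autotopisms G"
    if "t \<in> autotopisms G" "u \<in> autotopisms G" for t u
  proof -
    obtain a b c a' b' c' where t: "t = (a, b, c)" "u = (a', b', c')"
      by (metis prod_cases3)
    show ?thesis
      using that unfolding t
      by (subst mult_Atp) (auto simp: autotopisms_def compose_Bij compose_eq mem)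
  qed
  have one: "\<one>\<^bsub>Atp G\<^esub> \<in> autotopisms G"
    by (auto simp: one_Atp autotopisms_def id_Bij)
  have assoc: "(t \<otimes>\<^bsub>Atp G\<^esub> u) \<otimes>\<^bsub>Atp G\<^esub> v = t \<otimes>\<^bsub>Atp G\<^esub> (u \<otimes>\<^bsub>Atp G\<^esub> v)"
    if "t \<in> autotopisms G" "u \<in> autotopisms G" "v \<in> autotopisms G" for t u v
  proof -
    obtain a b c a' b' c' a'' b'' c''
      where t: "t = (a, b, c)" "u = (a', b', c')" "v = (a'', b'', c'')"
      by (metis prod_cases3)
    have "(a, b, c) \<otimes>\<^bsub>Atp G\<^esub> (a', b', c') \<in> autotopisms G"
         "(a', b', c') \<otimes>\<^bsub>Atp G\<^esub> (a'', b'', c'') \<in> autotopisms G"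
      using closed that t by blast+
    with that show ?thesis
      unfolding t
      by (simp add: mult_Atp)
        (auto simp: autotopisms_def Bij_imp_funcset compose_assoc [symmetric])
  qed
  have left_one: "\<one>\<^bsub>Atp G\<^esub> \<otimes>\<^bsub>Atp G\<^esub> t = t" if t: "t \<in> autotopisms G" for t
  proof -
    obtain a b c where abc: "t = (a, b, c)" by (metis prod_cases3)
    from t one show ?thesis
      unfolding abc one_Atp
      by (simp add: mult_Atp)
        (auto simp: autotopisms_def Id_compose Bij_imp_funcset Bij_imp_extensional)
  qed
  have left_inv: "\<exists>u \<in> autotopisms G. u \<otimes>\<^bsub>Atp G\<^esub> t = \<one>\<^bsub>Atp G\<^esub>"
    if t: "t \<in> autotopisms G" for t
  proof -
    obtain a b c where abc: "t = (a, b, c)" by (metis prod_cases3)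
    have B: "a \<in> Bij ?S" "b \<in> Bij ?S" "c \<in> Bij ?S"
      and h: "\<And>x y. x \<in> ?S \<Longrightarrow> y \<in> ?S \<Longrightarrow> a x \<otimes>\<^bsub>G\<^esub> b y = c (x \<otimes>\<^bsub>G\<^esub> y)"
      using t by (auto simp: abc autotopisms_def)
    define I where "I f = restrict (inv_into ?S f) ?S" for f :: "'a \<Rightarrow> 'a"
    have IB: "I f \<in> Bij ?S" if "f \<in> Bij ?S" for f
      unfolding I_def by (rule restrict_inv_into_Bij[OF that])
    have fI: "f (I f x) = x" if "f \<in> Bij ?S" "x \<in> ?S" for f x
      using that by (simp add: I_def Bij_def bij_betw_def f_inv_into_f)
    have If: "I f (f x) = x" if "f \<in> Bij ?S" "x \<in> ?S" for f x
      using that mem[OF that] by (simp add: I_def Bij_def bij_betw_def)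
    have eq: "I a x \<otimes>\<^bsub>G\<^esub> I b y = I c (x \<otimes>\<^bsub>G\<^esub> y)" if xy: "x \<in> ?S" "y \<in> ?S" for x y
    proof -
      have m: "I a x \<in> ?S" "I b y \<in> ?S" using mem IB B xy by blast+
      have "c (I a x \<otimes>\<^bsub>G\<^esub> I b y) = x \<otimes>\<^bsub>G\<^esub> y"
        using h[OF m] fI[OF B(1) xy(1)] fI[OF B(2) xy(2)] by simp
      then show ?thesis
        using If[OF B(3), of "I a x \<otimes>\<^bsub>G\<^esub> I b y"] m by simp
    qed
    have u: "(I a, I b, I c) \<in> autotopisms G"
      using IB B eq by (auto simp: autotopisms_def)
    have "(I a, I b, I c) \<otimes>\<^bsub>Atp G\<^esub> t = \<one>\<^bsub>Atp G\<^esub>"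
      using u t B unfolding abc one_Atp
      by (simp add: mult_Atp I_def Bij_compose_restrict_eq)
    with u show ?thesis by blast
  qed
  show ?thesis
    by (rule groupI) (use closed one assoc left_one left_inv in auto)
qed

end

theory Submission
  imports Defs "HOL-Algebra.Multiplicative_Group"
begin

text \<open>
  An autotopism \<open>(\<alpha>, \<beta>, \<gamma>)\<close> of a group has the form
  \<open>\<alpha> x = a \<cdot> \<phi> x\<close>, \<open>\<beta> x = \<phi> x \<cdot> b\<close>, \<open>\<gamma> x = a \<cdot> \<phi> x \<cdot> b\<close> with \<open>a = \<alpha> 1\<close>, \<open>b = \<beta> 1\<close> and \<open>\<phi>\<close> an
  endomorphism. By coprimality, homomorphisms between \<open>H\<close> and \<open>K\<close> are trivial, so every endomorphism of
  \<open>H \<times> K\<close> acts componentwise; hence so do \<open>\<alpha>\<close>, \<open>\<beta>\<close> and \<open>\<gamma>\<close>.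
\<close>

section \<open>Homomorphisms between groups of coprime order\<close>

text \<open>The order of \<open>f x\<close> divides \<open>order G\<close>, because \<open>f\<close>
  carries the \<open>order G\<close>-th power of \<open>x\<close> to the identity, and it divides
  \<open>order H\<close> by Lagrange; by coprimality it is 1.\<close>

lemma hom_coprime_order_trivial:
  assumes "group G" "group H" "coprime (order G) (order H)"
    and f: "f \<in> hom G H" and x: "x \<in> carrier G"
  shows "f x = \<one>\<^bsub>H\<^esub>"
proof -
  interpret G: group G by fact
  interpret H: group H by fact
  interpret f: group_hom G H f by unfold_locales (fact f)
  have fx: "f x \<in> carrier H" using x by simp
  have "f x [^]\<^bsub>H\<^esub> order G = \<one>\<^bsub>H\<^esub>"
    using x by (metis f.hom_nat_pow f.hom_one G.pow_order_eq_1)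
  then have "H.ord (f x) dvd order G" using fx by (simp add: H.pow_eq_id)
  moreover have "H.ord (f x) dvd order H" using fx by (rule H.ord_dvd_group_order)
  ultimately have "H.ord (f x) = 1"
    using assms(3) by (metis coprime_common_divisor_nat)
  then show ?thesis using H.ord_eq_1[OF fx] by blast
qed

text \<open>Since (x, y) = (x, 1)(1, y), the map \<open>f\<close> is a two by two matrix of
  homomorphisms. The two off-diagonal entries run between groups of coprime order, so they
  vanish.\<close>

lemma hom_DirProd_coprime_componentwise:
  assumes "group H" "group K" "coprime (order H) (order K)"
    and f: "f \<in> hom (H \<times>\<times> K) (H \<times>\<times> K)" and x: "x \<in> carrier H" and y: "y \<in> carrier K"
  shows "fst (f (x, y)) = fst (f (x, \<one>\<^bsub>K\<^esub>))" "snd (f (x, y)) = snd (f (\<one>\<^bsub>H\<^esub>, y))"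
proof -
  interpret H: group H by fact
  interpret K: group K by fact
  have split: "f (x, y) = f (x, \<one>\<^bsub>K\<^esub>) \<otimes>\<^bsub>H \<times>\<times> K\<^esub> f (\<one>\<^bsub>H\<^esub>, y)"
    using hom_mult[OF f, of "(x, \<one>\<^bsub>K\<^esub>)" "(\<one>\<^bsub>H\<^esub>, y)"] x y by simp
  have mem: "f (x, \<one>\<^bsub>K\<^esub>) \<in> carrier H \<times> carrier K" "f (\<one>\<^bsub>H\<^esub>, y) \<in> carrier H \<times> carrier K"
    using hom_in_carrier[OF f] x y by auto
  have mult: "f (p \<otimes>\<^bsub>H \<times>\<times> K\<^esub> q) = f p \<otimes>\<^bsub>H \<times>\<times> K\<^esub> f q"
    if "p \<in> carrier H \<times> carrier K" "q \<in> carrier H \<times> carrier K" for p q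
    using hom_mult[OF f] that by auto
  have car: "fst (f p) \<in> carrier H" "snd (f p) \<in> carrier K" if "p \<in> carrier H \<times> carrier K" for p
    using hom_in_carrier[OF f] that by (auto simp: mem_Times_iff)
  \<comment> \<open>The off-diagonal entry from \<open>K\<close> to \<open>H\<close>: include
    \<open>K\<close>, apply \<open>f\<close>, project to \<open>H\<close>.\<close>
  have "(\<lambda>y. fst (f (\<one>\<^bsub>H\<^esub>, y))) \<in> hom K H"
    using mult[of "(\<one>\<^bsub>H\<^esub>, _)" "(\<one>\<^bsub>H\<^esub>, _)"] car
    by (auto simp: hom_def mult_DirProd' mem_Times_iff)
  from hom_coprime_order_trivial[OF assms(2,1) _ this y]
  have 1: "fst (f (\<one>\<^bsub>H\<^esub>, y)) = \<one>\<^bsub>H\<^esub>"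
    using assms(3) by (simp add: coprime_commute)
  have "(\<lambda>x. snd (f (x, \<one>\<^bsub>K\<^esub>))) \<in> hom H K"
    using mult[of "(_, \<one>\<^bsub>K\<^esub>)" "(_, \<one>\<^bsub>K\<^esub>)"] car
    by (auto simp: hom_def mult_DirProd' mem_Times_iff)
  from hom_coprime_order_trivial[OF assms(1-3) this x]
  have 2: "snd (f (x, \<one>\<^bsub>K\<^esub>)) = \<one>\<^bsub>K\<^esub>" .
  show "fst (f (x, y)) = fst (f (x, \<one>\<^bsub>K\<^esub>))" "snd (f (x, y)) = snd (f (\<one>\<^bsub>H\<^esub>, y))"
    using split mem 1 2 by (auto simp: mult_DirProd' mem_Times_iff)
qed

section \<open>Autotopisms as an endomorphism with translations\<close>

text \<open>Putting one argument of the autotopism identity equal to the identity element expresses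
  \<gamma> through \<alpha> and b, and then \<beta> through \<gamma> and a. What remains of the
  identity says that \<phi>, which is \<alpha> normalised to fix the identity element, is
  multiplicative.\<close>

lemma (in group) autotopism_decompose:
  assumes "(\<alpha>, \<beta>, \<gamma>) \<in> autotopisms G"
  obtains a b \<phi> where "a \<in> carrier G" "b \<in> carrier G" "\<phi> \<in> hom G G"
    "\<And>x. x \<in> carrier G \<Longrightarrow> \<alpha> x = a \<otimes> \<phi> x"
    "\<And>x. x \<in> carrier G \<Longrightarrow> \<beta> x = \<phi> x \<otimes> b"
    "\<And>x. x \<in> carrier G \<Longrightarrow> \<gamma> x = a \<otimes> (\<phi> x \<otimes> b)"
proof -
  have B: "\<alpha> \<in> Bij (carrier G)" "\<beta> \<in> Bij (carrier G)"
    and h: "\<And>x y. x \<in> carrier G \<Longrightarrow> y \<in> carrier G \<Longrightarrow> \<alpha> x \<otimes> \<beta> y = \<gamma> (x \<otimes> y)"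
    using assms by (auto simp: autotopisms_def)
  have mem [simp]: "\<alpha> x \<in> carrier G" "\<beta> x \<in> carrier G" if "x \<in> carrier G" for x
    using B[THEN Bij_imp_funcset] that by auto
  define a b \<phi> where "a = \<alpha> \<one>" and "b = \<beta> \<one>" and "\<phi> x = inv a \<otimes> \<alpha> x" for x
  have ab [simp]: "a \<in> carrier G" "b \<in> carrier G" by (simp_all add: a_def b_def)
  have phi [simp]: "\<phi> x \<in> carrier G" if "x \<in> carrier G" for x
    using that by (simp add: \<phi>_def)
  have \<alpha>: "\<alpha> x = a \<otimes> \<phi> x" if "x \<in> carrier G" for x
    using that by (simp add: \<phi>_def m_assoc [symmetric])
  have \<gamma>: "\<gamma> x = a \<otimes> (\<phi> x \<otimes> b)" if "x \<in> carrier G" for x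
    using h[of x \<one>] that by (simp add: \<alpha> m_assoc flip: b_def)
  have \<beta>: "\<beta> x = \<phi> x \<otimes> b" if "x \<in> carrier G" for x
    using h[of \<one> x] that by (simp add: \<gamma> flip: a_def)
  have "\<phi> (x \<otimes> y) = \<phi> x \<otimes> \<phi> y" if "x \<in> carrier G" "y \<in> carrier G" for x y
  proof -
    \<comment> \<open>Both sides are \<gamma> of the product; \<open>a\<close> and \<open>b\<close>
      then cancel.\<close>
    have "a \<otimes> ((\<phi> x \<otimes> \<phi> y) \<otimes> b) = a \<otimes> (\<phi> (x \<otimes> y) \<otimes> b)"
      using h[OF that] that by (simp add: \<alpha> \<beta> \<gamma> m_assoc)
    then show ?thesis using that by simp
  qed
  then have "\<phi> \<in> hom G G" by (auto simp: hom_def)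
  then show thesis using that ab \<alpha> \<beta> \<gamma> by blast
qed

section \<open>Bijections of a product that act componentwise\<close>

text \<open>Without \<open>restrict\<close> the values off the product would be pairs such as
  \<open>(undefined, g y)\<close> instead of \<open>undefined\<close>, contrary to what
  \<open>Bij\<close> demands.\<close>

definition prod_fun :: "'a set \<Rightarrow> 'b set \<Rightarrow> ('a \<Rightarrow> 'a) \<Rightarrow> ('b \<Rightarrow> 'b) \<Rightarrow> 'a \<times> 'b \<Rightarrow> 'a \<times> 'b"
  where "prod_fun A B f g = restrict (map_prod f g) (A \<times> B)"

lemma prod_fun_apply [simp]: "x \<in> A \<Longrightarrow> y \<in> B \<Longrightarrow> prod_fun A B f g (x, y) = (f x, g y)"
  by (simp add: prod_fun_def)

lemma prod_fun_Bij:
  assumes "f \<in> Bij A" "g \<in> Bij B"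
  shows "prod_fun A B f g \<in> Bij (A \<times> B)"
  using assms bij_betw_map_prod[of f A A g B B] by (auto simp: prod_fun_def Bij_def)

lemma compose_prod_fun:
  assumes "f' \<in> A \<rightarrow> A" "g' \<in> B \<rightarrow> B"
  shows "compose (A \<times> B) (prod_fun A B f g) (prod_fun A B f' g') =
    prod_fun A B (compose A f f') (compose B g g')"
  using assms by (auto simp: compose_def prod_fun_def fun_eq_iff)

text \<open>A point of the other set is what allows a factor to be read off from the pair, hence the
  nonemptiness; extensionality settles the values off the sets.\<close>

lemma prod_fun_inject:
  assumes "prod_fun A B f g = prod_fun A B f' g'" "A \<noteq> {}" "B \<noteq> {}"
    and "f \<in> extensional A" "f' \<in> extensional A" "g \<in> extensional B" "g' \<in> extensional B"
  shows "f = f'" "g = g'"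
proof -
  have "f x = f' x \<and> g y = g' y" if "x \<in> A" "y \<in> B" for x y
    using fun_cong[OF assms(1), of "(x, y)"] that by simp
  with assms(2-) show "f = f'" "g = g'"
    by (auto intro: extensionalityI)
qed

text \<open>The factors are read off along the two slices through \<open>(a, b)\<close>; bijectivity
  of \<open>F\<close> then passes to each of them.\<close>

lemma Bij_componentwise:
  assumes F: "F \<in> Bij (A \<times> B)" and ne: "a \<in> A" "b \<in> B"
    and fst: "\<And>x y. x \<in> A \<Longrightarrow> y \<in> B \<Longrightarrow> fst (F (x, y)) = fst (F (x, b))"
    and snd: "\<And>x y. x \<in> A \<Longrightarrow> y \<in> B \<Longrightarrow> snd (F (x, y)) = snd (F (a, y))"
  obtains f g where "f \<in> Bij A" "g \<in> Bij B" "F = prod_fun A B f g"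
proof -
  define f g where "f = (\<lambda>x\<in>A. fst (F (x, b)))" and "g = (\<lambda>y\<in>B. snd (F (a, y)))"
  have F_eq: "F (x, y) = (f x, g y)" if "x \<in> A" "y \<in> B" for x y
    using fst[OF that] snd[OF that] that by (simp add: f_def g_def prod_eq_iff)
  have inj: "inj_on F (A \<times> B)" and img: "F ` (A \<times> B) = A \<times> B"
    using F by (auto simp: Bij_def bij_betw_def)
  have "F ` (A \<times> B) = f ` A \<times> g ` B" by (force simp: F_eq)
  \<comment> \<open>Equal products have equal factors because \<open>A\<close> and \<open>B\<close>
    are nonempty.\<close>
  then have surj: "f ` A = A" "g ` B = B" using img ne by (auto simp: times_eq_iff)
  \<comment> \<open>On the slice through \<open>b\<close> the second coordinate of \<open>F\<close>
    is constantly \<open>g b\<close>, so the first alone separates points.\<close>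
  have "inj_on f A" using inj_onD[OF inj, of "(_, b)" "(_, b)"] ne by (auto intro!: inj_onI simp: F_eq)
  moreover have "inj_on g B"
    using inj_onD[OF inj, of "(a, _)" "(a, _)"] ne by (auto intro!: inj_onI simp: F_eq)
  ultimately have fg: "f \<in> Bij A" "g \<in> Bij B"
    using surj by (auto simp: Bij_def bij_betw_def f_def g_def)
  have "F = prod_fun A B f g"
    using F by (intro extensionalityI[of _ "A \<times> B"])
      (auto simp: F_eq prod_fun_def Bij_imp_extensional)
  with fg show thesis using that by blast
qed

section \<open>The isomorphism from pairs of autotopisms\<close>

definition prod_triple ::
    "('a, 'm) monoid_scheme \<Rightarrow> ('b, 'n) monoid_scheme \<Rightarrow>
      (('a \<Rightarrow> 'a) \<times> ('a \<Rightarrow> 'a) \<times> ('a \<Rightarrow> 'a)) \<times> (('b \<Rightarrow> 'b) \<times> ('b \<Rightarrow> 'b) \<times> ('b \<Rightarrow> 'b)) \<Rightarrow>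
      ('a \<times> 'b \<Rightarrow> 'a \<times> 'b) \<times> ('a \<times> 'b \<Rightarrow> 'a \<times> 'b) \<times> ('a \<times> 'b \<Rightarrow> 'a \<times> 'b)"
  where "prod_triple H K = (\<lambda>((\<alpha>, \<beta>, \<gamma>), (\<alpha>', \<beta>', \<gamma>')).
    let P = prod_fun (carrier H) (carrier K) in (P \<alpha> \<alpha>', P \<beta> \<beta>', P \<gamma> \<gamma>'))"

text \<open>Multiplication in the product is componentwise, so the autotopism identity splits into
  one for each factor. One direction shows that \<open>prod_triple\<close> lands in the autotopisms,
  the other serves surjectivity.\<close>

lemma prod_triple_in_autotopisms_iff:
  assumes "group H" "group K"
    and B: "\<alpha> \<in> Bij (carrier H)" "\<beta> \<in> Bij (carrier H)" "\<gamma> \<in> Bij (carrier H)"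
      "\<alpha>' \<in> Bij (carrier K)" "\<beta>' \<in> Bij (carrier K)" "\<gamma>' \<in> Bij (carrier K)"
  shows "prod_triple H K ((\<alpha>, \<beta>, \<gamma>), (\<alpha>', \<beta>', \<gamma>')) \<in> autotopisms (H \<times>\<times> K) \<longleftrightarrow>
    (\<alpha>, \<beta>, \<gamma>) \<in> autotopisms H \<and> (\<alpha>', \<beta>', \<gamma>') \<in> autotopisms K"
proof -
  interpret H: group H by fact
  interpret K: group K by fact
  have "prod_triple H K ((\<alpha>, \<beta>, \<gamma>), (\<alpha>', \<beta>', \<gamma>')) \<in> autotopisms (H \<times>\<times> K) \<longleftrightarrow>
    (\<forall>x\<in>carrier H. \<forall>x'\<in>carrier K. \<forall>y\<in>carrier H. \<forall>y'\<in>carrier K.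
      \<alpha> x \<otimes>\<^bsub>H\<^esub> \<beta> y = \<gamma> (x \<otimes>\<^bsub>H\<^esub> y) \<and> \<alpha>' x' \<otimes>\<^bsub>K\<^esub> \<beta>' y' = \<gamma>' (x' \<otimes>\<^bsub>K\<^esub> y'))"
    using B by (simp add: prod_triple_def Let_def autotopisms_def prod_fun_Bij)
  \<comment> \<open>To separate the conjuncts, the variables of the other factor are instantiated by
    its identity element.\<close>
  also have "\<dots> \<longleftrightarrow> (\<alpha>, \<beta>, \<gamma>) \<in> autotopisms H \<and> (\<alpha>', \<beta>', \<gamma>') \<in> autotopisms K"
    using B by (simp add: autotopisms_def) (use H.one_closed K.one_closed in blast)
  finally show ?thesis .
qed

lemma prod_triple_hom:
  assumes "group H" "group K"
  shows "prod_triple H K \<in> hom (Atp H \<times>\<times> Atp K) (Atp (H \<times>\<times> K))"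
proof (rule homI)
  fix t assume t: "t \<in> carrier (Atp H \<times>\<times> Atp K)"
  obtain \<alpha> \<beta> \<gamma> \<alpha>' \<beta>' \<gamma>' where eq: "t = ((\<alpha>, \<beta>, \<gamma>), (\<alpha>', \<beta>', \<gamma>'))"
    by (cases t; cases "fst t" rule: prod_cases3; cases "snd t" rule: prod_cases3) auto
  show "prod_triple H K t \<in> carrier (Atp (H \<times>\<times> K))"
    using t assms unfolding eq carrier_Atp
    by (subst prod_triple_in_autotopisms_iff) (auto simp: autotopisms_def)
next
  fix s t assume st: "s \<in> carrier (Atp H \<times>\<times> Atp K)" "t \<in> carrier (Atp H \<times>\<times> Atp K)"
  obtain \<alpha> \<beta> \<gamma> \<alpha>' \<beta>' \<gamma>' where s: "s = ((\<alpha>, \<beta>, \<gamma>), (\<alpha>', \<beta>', \<gamma>'))"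
    by (cases s; cases "fst s" rule: prod_cases3; cases "snd s" rule: prod_cases3) auto
  obtain \<delta> \<epsilon> \<zeta> \<delta>' \<epsilon>' \<zeta>' where t: "t = ((\<delta>, \<epsilon>, \<zeta>), (\<delta>', \<epsilon>', \<zeta>'))"
    by (cases t; cases "fst t" rule: prod_cases3; cases "snd t" rule: prod_cases3) auto
  have aut: "(\<alpha>, \<beta>, \<gamma>) \<in> autotopisms H" "(\<alpha>', \<beta>', \<gamma>') \<in> autotopisms K"
    "(\<delta>, \<epsilon>, \<zeta>) \<in> autotopisms H" "(\<delta>', \<epsilon>', \<zeta>') \<in> autotopisms K"
    using st by (auto simp: s t)
  then have img: "prod_triple H K s \<in> autotopisms (H \<times>\<times> K)"
      "prod_triple H K t \<in> autotopisms (H \<times>\<times> K)"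
    unfolding s t using assms
    by (subst prod_triple_in_autotopisms_iff; auto simp: autotopisms_def)+
  \<comment> \<open>The maps from \<open>t\<close> are the inner ones in each composition, so
    \<open>compose_prod_fun\<close> asks that they preserve the carriers.\<close>
  have "\<delta> \<in> carrier H \<rightarrow> carrier H" "\<epsilon> \<in> carrier H \<rightarrow> carrier H" "\<zeta> \<in> carrier H \<rightarrow> carrier H"
    "\<delta>' \<in> carrier K \<rightarrow> carrier K" "\<epsilon>' \<in> carrier K \<rightarrow> carrier K" "\<zeta>' \<in> carrier K \<rightarrow> carrier K"
    using aut by (auto simp: autotopisms_def dest!: Bij_imp_funcset)
  then show "prod_triple H K (s \<otimes>\<^bsub>Atp H \<times>\<times> Atp K\<^esub> t) =
      prod_triple H K s \<otimes>\<^bsub>Atp (H \<times>\<times> K)\<^esub> prod_triple H K t"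
    using img aut
    by (simp add: s t mult_Atp prod_triple_def Let_def compose_prod_fun)
qed

lemma prod_triple_inj_on:
  assumes "group H" "group K"
  shows "inj_on (prod_triple H K) (autotopisms H \<times> autotopisms K)"
proof -
  interpret H: group H by fact
  interpret K: group K by fact
  have "carrier H \<noteq> {}" "carrier K \<noteq> {}" by auto
  note inject = prod_fun_inject[OF _ this]
  show ?thesis
  proof (rule inj_onI)
    fix s t assume st: "s \<in> autotopisms H \<times> autotopisms K" "t \<in> autotopisms H \<times> autotopisms K"
      and eq: "prod_triple H K s = prod_triple H K t"
    obtain \<alpha> \<beta> \<gamma> \<alpha>' \<beta>' \<gamma>' where s: "s = ((\<alpha>, \<beta>, \<gamma>), (\<alpha>', \<beta>', \<gamma>'))"
    by (cases s; cases "fst s" rule: prod_cases3; cases "snd s" rule: prod_cases3) auto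
    obtain \<delta> \<epsilon> \<zeta> \<delta>' \<epsilon>' \<zeta>' where t: "t = ((\<delta>, \<epsilon>, \<zeta>), (\<delta>', \<epsilon>', \<zeta>'))"
    by (cases t; cases "fst t" rule: prod_cases3; cases "snd t" rule: prod_cases3) auto
    have "f \<in> extensional (carrier H)" if "f \<in> {\<alpha>, \<beta>, \<gamma>, \<delta>, \<epsilon>, \<zeta>}" for f
      using st that by (auto simp: s t autotopisms_def Bij_imp_extensional)
    moreover have "f \<in> extensional (carrier K)" if "f \<in> {\<alpha>', \<beta>', \<gamma>', \<delta>', \<epsilon>', \<zeta>'}" for f
      using st that by (auto simp: s t autotopisms_def Bij_imp_extensional)
    moreover have "prod_fun (carrier H) (carrier K) \<alpha> \<alpha>' = prod_fun (carrier H) (carrier K) \<delta> \<delta>'"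
      "prod_fun (carrier H) (carrier K) \<beta> \<beta>' = prod_fun (carrier H) (carrier K) \<epsilon> \<epsilon>'"
      "prod_fun (carrier H) (carrier K) \<gamma> \<gamma>' = prod_fun (carrier H) (carrier K) \<zeta> \<zeta>'"
      using eq by (simp_all add: s t prod_triple_def Let_def)
    ultimately have "\<alpha> = \<delta>" "\<alpha>' = \<delta>'" "\<beta> = \<epsilon>" "\<beta>' = \<epsilon>'" "\<gamma> = \<zeta>" "\<gamma>' = \<zeta>'"
      by (blast intro: inject)+
    then show "s = t" by (simp add: s t)
  qed
qed

text \<open>Each map of the triple splits into bijections of the factors by
  \<open>Bij_componentwise\<close>; that these form autotopisms follows from
  \<open>prod_triple_in_autotopisms_iff\<close>.\<close>

lemma prod_triple_surj:
  assumes "group H" "group K" "coprime (order H) (order K)"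
    and t: "t \<in> autotopisms (H \<times>\<times> K)"
  shows "t \<in> prod_triple H K ` (autotopisms H \<times> autotopisms K)"
proof -
  interpret H: group H by fact
  interpret K: group K by fact
  interpret HK: group "H \<times>\<times> K" by (rule DirProd_group) fact+
  obtain \<alpha> \<beta> \<gamma> where t_eq: "t = (\<alpha>, \<beta>, \<gamma>)" by (metis prod_cases3)
  obtain a b \<phi> where ab: "a \<in> carrier (H \<times>\<times> K)" "b \<in> carrier (H \<times>\<times> K)"
    and \<phi>: "\<phi> \<in> hom (H \<times>\<times> K) (H \<times>\<times> K)"
    and eqs: "\<And>x. x \<in> carrier (H \<times>\<times> K) \<Longrightarrow> \<alpha> x = a \<otimes>\<^bsub>H \<times>\<times> K\<^esub> \<phi> x"
      "\<And>x. x \<in> carrier (H \<times>\<times> K) \<Longrightarrow> \<beta> x = \<phi> x \<otimes>\<^bsub>H \<times>\<times> K\<^esub> b"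
      "\<And>x. x \<in> carrier (H \<times>\<times> K) \<Longrightarrow> \<gamma> x = a \<otimes>\<^bsub>H \<times>\<times> K\<^esub> (\<phi> x \<otimes>\<^bsub>H \<times>\<times> K\<^esub> b)"
    using HK.autotopism_decompose[OF t[unfolded t_eq]] by metis
  note comp = hom_DirProd_coprime_componentwise[OF assms(1-3) \<phi>]
  have split: "\<exists>f g. f \<in> Bij (carrier H) \<and> g \<in> Bij (carrier K) \<and>
      F = prod_fun (carrier H) (carrier K) f g"
    if F: "F \<in> {\<alpha>, \<beta>, \<gamma>}" for F
  proof (rule Bij_componentwise[of F "carrier H" "carrier K" "\<one>\<^bsub>H\<^esub>" "\<one>\<^bsub>K\<^esub>"])
    show "F \<in> Bij (carrier H \<times> carrier K)"
      using t F by (auto simp: t_eq autotopisms_def)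
    fix x y assume xy: "x \<in> carrier H" "y \<in> carrier K"
    \<comment> \<open>Multiplication by the fixed pairs \<open>a\<close> and \<open>b\<close> is
      coordinatewise, so \<open>F\<close> inherits the property from \<phi>.\<close>
    show "fst (F (x, y)) = fst (F (x, \<one>\<^bsub>K\<^esub>))" "snd (F (x, y)) = snd (F (\<one>\<^bsub>H\<^esub>, y))"
      using F xy comp[OF xy] by (auto simp: eqs mult_DirProd')
  qed auto
  obtain \<alpha>1 \<alpha>2 where 1: "\<alpha>1 \<in> Bij (carrier H)" "\<alpha>2 \<in> Bij (carrier K)"
    "\<alpha> = prod_fun (carrier H) (carrier K) \<alpha>1 \<alpha>2" using split[of \<alpha>] by auto
  obtain \<beta>1 \<beta>2 where 2: "\<beta>1 \<in> Bij (carrier H)" "\<beta>2 \<in> Bij (carrier K)"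
    "\<beta> = prod_fun (carrier H) (carrier K) \<beta>1 \<beta>2" using split[of \<beta>] by auto
  obtain \<gamma>1 \<gamma>2 where 3: "\<gamma>1 \<in> Bij (carrier H)" "\<gamma>2 \<in> Bij (carrier K)"
    "\<gamma> = prod_fun (carrier H) (carrier K) \<gamma>1 \<gamma>2" using split[of \<gamma>] by auto
  have eq: "t = prod_triple H K ((\<alpha>1, \<beta>1, \<gamma>1), (\<alpha>2, \<beta>2, \<gamma>2))"
    by (simp add: t_eq prod_triple_def Let_def 1 2 3)
  then have "(\<alpha>1, \<beta>1, \<gamma>1) \<in> autotopisms H \<and> (\<alpha>2, \<beta>2, \<gamma>2) \<in> autotopisms K"
    using t prod_triple_in_autotopisms_iff[OF assms(1,2) 1(1) 2(1) 3(1) 1(2) 2(2) 3(2)] by simp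
  with eq show ?thesis by blast
qed

theorem corollary4p3:
  fixes H :: "('a, 'm) monoid_scheme" and K :: "('b, 'n) monoid_scheme"
  assumes "group H" and "finite (carrier H)"
    and "group K" and "finite (carrier K)"
    and "coprime (order H) (order K)"
  shows "Atp (H \<times>\<times> K) \<cong> Atp H \<times>\<times> Atp K"
proof -
  \<comment> \<open>The isomorphism is built out of this group; reversing it with
    \<open>iso_sym\<close> at the end relies on the group structure here.\<close>
  interpret D: group "Atp H \<times>\<times> Atp K"
    using assms by (intro DirProd_group group_Atp)
  have hom: "prod_triple H K \<in> hom (Atp H \<times>\<times> Atp K) (Atp (H \<times>\<times> K))"
    using assms by (intro prod_triple_hom)
  then have "prod_triple H K ` (autotopisms H \<times> autotopisms K) = autotopisms (H \<times>\<times> K)"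
    using prod_triple_surj[OF assms(1,3,5)] by (auto simp: hom_def)
  then have "prod_triple H K \<in> iso (Atp H \<times>\<times> Atp K) (Atp (H \<times>\<times> K))"
    using hom prod_triple_inj_on[OF assms(1,3)] by (simp add: iso_def bij_betw_def)
  then have "Atp H \<times>\<times> Atp K \<cong> Atp (H \<times>\<times> K)" by (auto simp: is_iso_def)
  then show ?thesis by (rule D.iso_sym)
qed

end
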